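(* Let $X$ and $Y$ be connected based CW-complexes. If $X$ and $Y$ have the same homotopy type, then $N\mathcal{E}(X)=N\mathcal{E}(Y)$.
   Context: All spaces are based and have the based homotopy type of a CW-complex; all maps and homotopies preserve base points (in particular, "same homotopy type" means based homotopy equivalent). For a connected space $X$, $[X,X]$ is the monoid (under composition) of based homotopy classes of based self-maps of $X$, and $\mathcal{E}(X)\subseteq[X,X]$ is the group of classes of self-homotopy equivalences. For a nonnegative integer $k$, $\mathcal{A}_\sharp^k(X)\subseteq[X,X]$ is the set of classes $f$ such that the induced map $\pi_i(f):\pi_i(X)\to\pi_i(X)$ is an isomorphism for all $i=0,1,\dots,k$. One always has $\mathcal{E}(X)\subseteq\mathcal{A}_\sharp^k(X)$. The self-closeness number of $X$ is $N\mathcal{E}(X)=\min\{k\geq 0 : \mathcal{A}_\sharp^k(X)=\mathcal{E}(X)\}$, with $N\mathcal{E}(X)=\infty$ if no such nonnegative integer $k$ exists. *)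

theory Defs
  imports "HOL-Analysis.Analysis" "HOL-Library.Extended_Nat" "HOL-Algebra.Group"
begin

section \<open>Discs, cubes and CW-complexes\<close>

text \<open>The library's \<^term>\<open>Euclidean_space n\<close> consists of the real sequences vanishing from
  index \<open>n\<close> on, so the dimension is an ordinary natural number.\<close>

definition disc :: "nat \<Rightarrow> (nat \<Rightarrow> real) set" where
  "disc n = {x \<in> topspace (Euclidean_space n). (\<Sum>i<n. (x i)\<^sup>2) \<le> 1}"

definition open_disc :: "nat \<Rightarrow> (nat \<Rightarrow> real) set" where
  "open_disc n = {x \<in> topspace (Euclidean_space n). (\<Sum>i<n. (x i)\<^sup>2) < 1}"

definition disc_boundary :: "nat \<Rightarrow> (nat \<Rightarrow> real) set" where
  "disc_boundary n = {x \<in> topspace (Euclidean_space n). (\<Sum>i<n. (x i)\<^sup>2) = 1}"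

text \<open>A cell is given by its dimension and its characteristic map.\<close>

type_synonym 'a cell = "nat \<times> ((nat \<Rightarrow> real) \<Rightarrow> 'a)"

definition open_cell :: "'a cell \<Rightarrow> 'a set" where
  "open_cell c = snd c ` open_disc (fst c)"

definition CW_structure :: "'a topology \<Rightarrow> 'a cell set \<Rightarrow> bool" where
  "CW_structure X C \<longleftrightarrow>
     Hausdorff_space X \<and>
     (\<forall>(n, \<Phi>) \<in> C.
        continuous_map (subtopology (Euclidean_space n) (disc n)) X \<Phi> \<and>
        embedding_map (subtopology (Euclidean_space n) (open_disc n)) X \<Phi> \<and>
        (\<exists>D \<subseteq> C. finite D \<and> (\<forall>d \<in> D. fst d < n) \<and>
           \<Phi> ` disc_boundary n \<subseteq> (\<Union>d \<in> D. open_cell d))) \<and>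
     pairwise (\<lambda>c d. disjnt (open_cell c) (open_cell d)) C \<and>
     (\<Union>c \<in> C. open_cell c) = topspace X \<and>
     (\<forall>A \<subseteq> topspace X.
        closedin X A \<longleftrightarrow> (\<forall>c \<in> C. closedin X (A \<inter> X closure_of open_cell c)))"

text \<open>The base point of a based CW-complex is a vertex. Since the cell structure is
  existentially quantified, this is no restriction: any point of a CW-complex
  becomes a vertex after subdivision.\<close>

definition based_CW_complex :: "'a topology \<Rightarrow> 'a \<Rightarrow> bool" where
  "based_CW_complex X x0 \<longleftrightarrow>
     (\<exists>C. CW_structure X C \<and> (\<exists>\<Phi>. (0, \<Phi>) \<in> C \<and> open_cell (0, \<Phi>) = {x0}))"

section \<open>Based maps and based homotopy classes\<close>

definition based_map :: "'a topology \<Rightarrow> 'a \<Rightarrow> 'b topology \<Rightarrow> 'b \<Rightarrow> ('a \<Rightarrow> 'b) \<Rightarrow> bool" where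
  "based_map X x0 Y y0 f \<longleftrightarrow> continuous_map X Y f \<and> f x0 = y0"

definition based_homotopic ::
    "'a topology \<Rightarrow> 'a \<Rightarrow> 'b topology \<Rightarrow> 'b \<Rightarrow> ('a \<Rightarrow> 'b) \<Rightarrow> ('a \<Rightarrow> 'b) \<Rightarrow> bool" where
  "based_homotopic X x0 Y y0 = homotopic_with (\<lambda>h. h x0 = y0) X Y"

definition based_homotopy_equivalence ::
    "'a topology \<Rightarrow> 'a \<Rightarrow> 'b topology \<Rightarrow> 'b \<Rightarrow> ('a \<Rightarrow> 'b) \<Rightarrow> bool" where
  "based_homotopy_equivalence X x0 Y y0 f \<longleftrightarrow>
     based_map X x0 Y y0 f \<and>
     (\<exists>g. based_map Y y0 X x0 g \<and>
          based_homotopic X x0 X x0 (g \<circ> f) id \<and>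
          based_homotopic Y y0 Y y0 (f \<circ> g) id)"

definition same_based_homotopy_type ::
    "'a topology \<Rightarrow> 'a \<Rightarrow> 'b topology \<Rightarrow> 'b \<Rightarrow> bool" where
  "same_based_homotopy_type X x0 Y y0 \<longleftrightarrow> (\<exists>f. based_homotopy_equivalence X x0 Y y0 f)"

definition based_classes ::
    "'a topology \<Rightarrow> 'a \<Rightarrow> 'b topology \<Rightarrow> 'b \<Rightarrow> ('a \<Rightarrow> 'b) set set" where
  "based_classes X x0 Y y0 =
     {f. based_map X x0 Y y0 f} // {(f, g). based_homotopic X x0 Y y0 f g}"

text \<open>The underlying set of the group of self-homotopy equivalences.\<close>

definition self_equivalences :: "'a topology \<Rightarrow> 'a \<Rightarrow> ('a \<Rightarrow> 'a) set set" where
  "self_equivalences X x0 =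
     {f. based_homotopy_equivalence X x0 X x0 f} // {(f, g). based_homotopic X x0 X x0 f g}"

section \<open>Homotopy groups\<close>

definition cube :: "nat \<Rightarrow> (nat \<Rightarrow> real) set" where
  "cube n = {x \<in> topspace (Euclidean_space n). \<forall>i<n. 0 \<le> x i \<and> x i \<le> 1}"

definition cube_boundary :: "nat \<Rightarrow> (nat \<Rightarrow> real) set" where
  "cube_boundary n = {x \<in> cube n. \<exists>i<n. x i = 0 \<or> x i = 1}"

definition spheroid :: "nat \<Rightarrow> 'a topology \<Rightarrow> 'a \<Rightarrow> ((nat \<Rightarrow> real) \<Rightarrow> 'a) \<Rightarrow> bool" where
  "spheroid n X x0 a \<longleftrightarrow>
     continuous_map (subtopology (Euclidean_space n) (cube n)) X a \<and>
     (\<forall>t \<in> cube_boundary n. a t = x0)"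

definition spheroid_homotopic ::
    "nat \<Rightarrow> 'a topology \<Rightarrow> 'a \<Rightarrow> ((nat \<Rightarrow> real) \<Rightarrow> 'a) \<Rightarrow> ((nat \<Rightarrow> real) \<Rightarrow> 'a) \<Rightarrow> bool" where
  "spheroid_homotopic n X x0 =
     homotopic_with (\<lambda>h. \<forall>t \<in> cube_boundary n. h t = x0)
       (subtopology (Euclidean_space n) (cube n)) X"

definition concat_spheroid ::
    "((nat \<Rightarrow> real) \<Rightarrow> 'a) \<Rightarrow> ((nat \<Rightarrow> real) \<Rightarrow> 'a) \<Rightarrow> (nat \<Rightarrow> real) \<Rightarrow> 'a" where
  "concat_spheroid a b t =
     (if t 0 \<le> 1/2 then a (t(0 := 2 * t 0)) else b (t(0 := 2 * t 0 - 1)))"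

text \<open>For \<open>n = 0\<close> only the carrier is meaningful: the cube is a point with empty boundary, and
  the carrier is the set of path components.\<close>

definition homotopy_group ::
    "nat \<Rightarrow> 'a topology \<Rightarrow> 'a \<Rightarrow> ((nat \<Rightarrow> real) \<Rightarrow> 'a) set monoid" where
  "homotopy_group n X x0 =
     \<lparr>carrier = {a. spheroid n X x0 a} // {(a, b). spheroid_homotopic n X x0 a b},
      mult = (\<lambda>A B. {c. \<exists>a \<in> A. \<exists>b \<in> B. spheroid_homotopic n X x0 (concat_spheroid a b) c}),
      one = {c. spheroid_homotopic n X x0 (\<lambda>_. x0) c}\<rparr>"

definition homotopy_group_map ::
    "nat \<Rightarrow> 'b topology \<Rightarrow> 'b \<Rightarrow> ('a \<Rightarrow> 'b) set \<Rightarrow>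
     ((nat \<Rightarrow> real) \<Rightarrow> 'a) set \<Rightarrow> ((nat \<Rightarrow> real) \<Rightarrow> 'b) set" where
  "homotopy_group_map n Y y0 F A =
     {c. \<exists>f \<in> F. \<exists>a \<in> A. spheroid_homotopic n Y y0 (f \<circ> a) c}"

definition induces_iso :: "nat \<Rightarrow> 'a topology \<Rightarrow> 'a \<Rightarrow> ('a \<Rightarrow> 'a) set \<Rightarrow> bool" where
  "induces_iso n X x0 F \<longleftrightarrow>
     (if n = 0
      then bij_betw (homotopy_group_map 0 X x0 F)
             (carrier (homotopy_group 0 X x0)) (carrier (homotopy_group 0 X x0))
      else homotopy_group_map n X x0 F \<in> iso (homotopy_group n X x0) (homotopy_group n X x0))"

section \<open>The self-closeness number\<close>

definition A_sharp :: "nat \<Rightarrow> 'a topology \<Rightarrow> 'a \<Rightarrow> ('a \<Rightarrow> 'a) set set" where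
  "A_sharp k X x0 = {F \<in> based_classes X x0 X x0. \<forall>i\<le>k. induces_iso i X x0 F}"

definition self_closeness_number :: "'a topology \<Rightarrow> 'a \<Rightarrow> enat" where
  "self_closeness_number X x0 =
     (if \<exists>k. A_sharp k X x0 = self_equivalences X x0
      then enat (LEAST k. A_sharp k X x0 = self_equivalences X x0)
      else \<infinity>)"

end

theory Submission imports Defs begin

text \<open>
  The self-closeness number is determined by the set of all \<open>k\<close> for which a self-map inducing
  isomorphisms on \<open>\<pi>\<^sub>0, \<dots>, \<pi>\<^sub>k\<close> must be a homotopy equivalence, so this property of \<open>k\<close> has to
  be carried from one space to the other. Let \<open>f : X \<rightarrow> Y\<close> be a based homotopy equivalence with
  homotopy inverse \<open>g\<close>. If \<open>h\<close> is a self-map of \<open>X\<close> inducing isomorphisms up to degree \<open>k\<close>, then so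
  is its conjugate \<open>f \<circ> h \<circ> g\<close> on \<open>Y\<close>, because \<open>\<pi>\<^sub>n\<close> is a functor on based homotopy classes and
  therefore turns \<open>f\<close> and \<open>g\<close> into bijections (\<open>bij_betw_homotopy_group_map_equivalence\<close>). If the
  property holds for \<open>Y\<close>, the conjugate is a homotopy equivalence; conjugating back,
  \<open>h \<simeq> g \<circ> (f \<circ> h \<circ> g) \<circ> f\<close> is one too. By symmetry, \<open>X\<close> and \<open>Y\<close> have the property for the
  same \<open>k\<close>.

  Isomorphisms of groups need no separate transport: the map induced by a based map is a
  homomorphism in every positive degree, so that \<open>induces_iso\<close> amounts to bijectivity (\<open>induces_iso_iff_bij_betw\<close>).
  Its proof rests on concatenation of spheroids being well defined on homotopy classes
  (\<open>spheroid_homotopic_concat\<close>).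
\<close>

section \<open>Based homotopies and composition\<close>

text \<open>Based homotopies and homotopies of spheroids are both homotopies constant on a fixed set,
  so this one statement yields that composition is well defined for either.\<close>

lemma homotopic_constant_on_compose:
  assumes a: "homotopic_with (\<lambda>h. \<forall>t\<in>B. h t = x0) Z X a a'"
    and f: "based_homotopic X x0 Y y0 f f'"
  shows "homotopic_with (\<lambda>h. \<forall>t\<in>B. h t = y0) Z Y (f \<circ> a) (f' \<circ> a')"
proof (rule homotopic_with_trans)
  have "continuous_map X Y f" "f x0 = y0"
    using f homotopic_with_imp_continuous_maps homotopic_with_imp_property
    unfolding based_homotopic_def by blast+
  then show "homotopic_with (\<lambda>h. \<forall>t\<in>B. h t = y0) Z Y (f \<circ> a) (f \<circ> a')"
    by (auto intro: homotopic_with_compose_continuous_map_left [OF a])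
  have "continuous_map Z X a'" "\<forall>t\<in>B. a' t = x0"
    using homotopic_with_imp_continuous_maps [OF a] homotopic_with_imp_property [OF a] by blast+
  then show "homotopic_with (\<lambda>h. \<forall>t\<in>B. h t = y0) Z Y (f \<circ> a') (f' \<circ> a')"
    using f unfolding based_homotopic_def
    by (auto intro: homotopic_with_compose_continuous_map_right)
qed

lemma based_homotopic_compose:
  assumes "based_homotopic X x0 Y y0 f f'" and "based_homotopic Y y0 Z z0 g g'"
  shows "based_homotopic X x0 Z z0 (g \<circ> f) (g' \<circ> f')"
  using homotopic_constant_on_compose [where B = "{x0}", OF _ assms(2)] assms(1)
  by (simp add: based_homotopic_def)

lemma spheroid_homotopic_compose:
  assumes "spheroid_homotopic n X x0 a a'" and "based_homotopic X x0 Y y0 f f'"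
  shows "spheroid_homotopic n Y y0 (f \<circ> a) (f' \<circ> a')"
  using homotopic_constant_on_compose [OF _ assms(2)] assms(1)
  by (simp add: spheroid_homotopic_def)

lemma based_homotopic_refl_iff: "based_homotopic X x0 Y y0 f f \<longleftrightarrow> based_map X x0 Y y0 f"
  by (simp add: based_homotopic_def based_map_def)

lemma based_homotopic_sym: "based_homotopic X x0 Y y0 f g \<Longrightarrow> based_homotopic X x0 Y y0 g f"
  by (simp add: based_homotopic_def homotopic_with_symD)

lemma based_homotopic_trans [trans]:
  "based_homotopic X x0 Y y0 f g \<Longrightarrow> based_homotopic X x0 Y y0 g h \<Longrightarrow>
    based_homotopic X x0 Y y0 f h"
  unfolding based_homotopic_def by (rule homotopic_with_trans)

lemma based_homotopic_imp_based_map: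
  assumes "based_homotopic X x0 Y y0 f g"
  shows "based_map X x0 Y y0 f" and "based_map X x0 Y y0 g"
  unfolding based_homotopic_refl_iff [symmetric]
  using based_homotopic_trans [OF assms based_homotopic_sym [OF assms]]
    based_homotopic_trans [OF based_homotopic_sym [OF assms] assms] by simp_all

lemma based_map_id: "based_map X x0 X x0 id"
  by (simp add: based_map_def)

lemma based_map_compose:
  "based_map X x0 Y y0 f \<Longrightarrow> based_map Y y0 Z z0 g \<Longrightarrow> based_map X x0 Z z0 (g \<circ> f)"
  by (auto simp: based_map_def intro: continuous_map_compose)

lemma spheroid_homotopic_refl_iff: "spheroid_homotopic n X x0 a a \<longleftrightarrow> spheroid n X x0 a"
  by (simp add: spheroid_homotopic_def spheroid_def)

lemma spheroid_homotopic_trans: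
  "spheroid_homotopic n X x0 a b \<Longrightarrow> spheroid_homotopic n X x0 b c \<Longrightarrow>
    spheroid_homotopic n X x0 a c"
  unfolding spheroid_homotopic_def by (rule homotopic_with_trans)

lemma spheroid_compose:
  "spheroid n X x0 a \<Longrightarrow> based_map X x0 Y y0 f \<Longrightarrow> spheroid n Y y0 (f \<circ> a)"
  by (metis spheroid_homotopic_compose spheroid_homotopic_refl_iff based_homotopic_refl_iff)

definition based_class ::
    "'a topology \<Rightarrow> 'a \<Rightarrow> 'b topology \<Rightarrow> 'b \<Rightarrow> ('a \<Rightarrow> 'b) \<Rightarrow> ('a \<Rightarrow> 'b) set" where
  "based_class X x0 Y y0 f = {g. based_homotopic X x0 Y y0 f g}"

definition spheroid_class ::
    "nat \<Rightarrow> 'a topology \<Rightarrow> 'a \<Rightarrow> ((nat \<Rightarrow> real) \<Rightarrow> 'a) \<Rightarrow> ((nat \<Rightarrow> real) \<Rightarrow> 'a) set" where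
  "spheroid_class n X x0 a = {b. spheroid_homotopic n X x0 a b}"

lemma based_classes_eq_image:
  "based_classes X x0 Y y0 = based_class X x0 Y y0 ` {f. based_map X x0 Y y0 f}"
  by (auto simp: based_classes_def based_class_def quotient_def)

lemma self_equivalences_eq_image:
  "self_equivalences X x0 = based_class X x0 X x0 ` {f. based_homotopy_equivalence X x0 X x0 f}"
  by (auto simp: self_equivalences_def based_class_def quotient_def)

lemma carrier_homotopy_group:
  "carrier (homotopy_group n X x0) = spheroid_class n X x0 ` {a. spheroid n X x0 a}"
  by (auto simp: homotopy_group_def spheroid_class_def quotient_def)

lemma based_class_eq_iff:
  assumes "based_map X x0 Y y0 g"
  shows "based_class X x0 Y y0 f = based_class X x0 Y y0 g \<longleftrightarrow> based_homotopic X x0 Y y0 f g"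
proof
  have "g \<in> based_class X x0 Y y0 g"
    using assms by (simp add: based_class_def based_homotopic_refl_iff)
  moreover assume "based_class X x0 Y y0 f = based_class X x0 Y y0 g"
  ultimately show "based_homotopic X x0 Y y0 f g"
    by (auto simp: based_class_def)
next
  assume "based_homotopic X x0 Y y0 f g"
  then show "based_class X x0 Y y0 f = based_class X x0 Y y0 g"
    by (auto simp: based_class_def intro: based_homotopic_sym based_homotopic_trans)
qed

section \<open>Concatenation of spheroids\<close>

text \<open>In the first coordinate, either half of the cube is stretched to the whole cube by
  \<open>s \<mapsto> 2 * s - c\<close> with \<open>c = 0\<close> or \<open>c = 1\<close>.\<close>

lemma continuous_map_stretch_cube:
  fixes T :: "'p topology" and n :: nat and c :: real and q :: "'p \<Rightarrow> nat \<Rightarrow> real"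
  defines "C \<equiv> subtopology (Euclidean_space n) (cube n)"
  assumes q: "continuous_map T C q" and "0 < n"
    and bounds: "\<And>p. p \<in> topspace T \<Longrightarrow> c \<le> 2 * q p 0 \<and> 2 * q p 0 \<le> 1 + c"
  shows "continuous_map T C (\<lambda>p. (q p)(0 := 2 * q p 0 - c))"
proof -
  have coord: "continuous_map T euclideanreal (\<lambda>p. q p i)" for i
    using q by (simp add: C_def Euclidean_space_def continuous_map_in_subtopology
        continuous_map_componentwise_UNIV)
  have "continuous_map T euclideanreal (\<lambda>p. ((q p)(0 := 2 * q p 0 - c)) i)" for i
    by (cases "i = 0") (auto intro!: continuous_intros coord)
  moreover have "(q p)(0 := 2 * q p 0 - c) \<in> cube n" if "p \<in> topspace T" for p
  proof -
    have "q p \<in> cube n"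
      using q that by (auto simp: C_def continuous_map_in_subtopology)
    then show ?thesis
      using bounds [OF that] \<open>0 < n\<close> by (auto simp: cube_def topspace_Euclidean_space)
  qed
  ultimately show ?thesis
    by (auto simp: C_def Euclidean_space_def continuous_map_in_subtopology
        continuous_map_componentwise_UNIV cube_def)
qed

text \<open>A coordinate of \<open>t\<close> equal to \<open>0\<close> or \<open>1\<close> keeps that value after stretching: the first
  coordinate can only be \<open>0\<close> in the left half and only \<open>1\<close> in the right half, and these are the
  fixed points of \<open>s \<mapsto> 2 * s\<close> and \<open>s \<mapsto> 2 * s - 1\<close>.\<close>

lemma concat_spheroid_boundary:
  assumes a: "\<forall>t\<in>cube_boundary n. a t = x0" and b: "\<forall>t\<in>cube_boundary n. b t = x0"
    and t: "t \<in> cube_boundary n"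
  shows "concat_spheroid a b t = x0"
proof -
  obtain i where i: "t \<in> cube n" "i < n" "t i = 0 \<or> t i = 1"
    using t by (auto simp: cube_boundary_def)
  show ?thesis
  proof (cases "t 0 \<le> 1/2")
    case True
    then have "t(0 := 2 * t 0) \<in> cube n"
      using i by (simp add: cube_def topspace_Euclidean_space)
    moreover have "(t(0 := 2 * t 0)) i = 0 \<or> (t(0 := 2 * t 0)) i = 1"
      using i True by (cases "i = 0") auto
    ultimately have "t(0 := 2 * t 0) \<in> cube_boundary n"
      using i(2) unfolding cube_boundary_def by blast
    then show ?thesis
      using True a by (simp add: concat_spheroid_def)
  next
    case False
    then have "t(0 := 2 * t 0 - 1) \<in> cube n"
      using i by (auto simp: cube_def topspace_Euclidean_space)
    moreover have "(t(0 := 2 * t 0 - 1)) i = 0 \<or> (t(0 := 2 * t 0 - 1)) i = 1"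
      using i False by (cases "i = 0") auto
    ultimately have "t(0 := 2 * t 0 - 1) \<in> cube_boundary n"
      using i(2) unfolding cube_boundary_def by blast
    then show ?thesis
      using False b by (simp add: concat_spheroid_def)
  qed
qed

text \<open>Two homotopies are concatenated at each time separately. The result is continuous because
  the two halves are closed and both homotopies take the value \<open>x0\<close> on the common face.\<close>

lemma spheroid_homotopic_concat:
  assumes a: "spheroid_homotopic n X x0 a a'" and b: "spheroid_homotopic n X x0 b b'"
    and n: "0 < n"
  shows "spheroid_homotopic n X x0 (concat_spheroid a b) (concat_spheroid a' b')"
proof -
  define C where "C = subtopology (Euclidean_space n) (cube n)"
  define T where "T = prod_topology (top_of_set {0..1::real}) C"
  obtain H where H: "continuous_map T X H" "\<And>t. H (0, t) = a t" "\<And>t. H (1, t) = a' t"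
      "\<And>s. s \<in> {0..1} \<Longrightarrow> \<forall>t\<in>cube_boundary n. H (s, t) = x0"
    using a unfolding spheroid_homotopic_def homotopic_with_def T_def C_def by auto
  obtain K where K: "continuous_map T X K" "\<And>t. K (0, t) = b t" "\<And>t. K (1, t) = b' t"
      "\<And>s. s \<in> {0..1} \<Longrightarrow> \<forall>t\<in>cube_boundary n. K (s, t) = x0"
    using b unfolding spheroid_homotopic_def homotopic_with_def T_def C_def by auto
  define L where "L p = concat_spheroid (\<lambda>t. H (fst p, t)) (\<lambda>t. K (fst p, t)) (snd p)" for p
  have topT: "p \<in> topspace T \<longleftrightarrow> fst p \<in> {0..1} \<and> snd p \<in> cube n" for p
    by (cases p) (auto simp: T_def C_def cube_def)
  have stretch: "continuous_map (subtopology T S) T (\<lambda>p. (fst p, (snd p)(0 := 2 * snd p 0 - c)))"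
    if "\<And>p. p \<in> topspace T \<Longrightarrow> p \<in> S \<Longrightarrow> c \<le> 2 * snd p 0 \<and> 2 * snd p 0 \<le> 1 + c" for S c
  proof -
    have "continuous_map (subtopology T S) (top_of_set {0..1}) fst"
      and "continuous_map (subtopology T S) C snd"
      unfolding T_def
      by (auto intro: continuous_map_from_subtopology continuous_map_fst continuous_map_snd)
    moreover from this(2)
    have "continuous_map (subtopology T S) C (\<lambda>p. (snd p)(0 := 2 * snd p 0 - c))"
      unfolding C_def using n that by (intro continuous_map_stretch_cube) auto
    ultimately show ?thesis
      unfolding T_def by (intro continuous_map_pairedI)
  qed
  have range: "0 \<le> snd p 0 \<and> snd p 0 \<le> 1" if "p \<in> topspace T" for p
    using that n by (auto simp: topT cube_def)
  have "continuous_map T X (\<lambda>p. if snd p 0 \<le> 1/2 then H (fst p, (snd p)(0 := 2 * snd p 0 - 0))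
          else K (fst p, (snd p)(0 := 2 * snd p 0 - 1)))"
  proof (rule continuous_map_cases_le)
    have "continuous_map T C snd"
      unfolding T_def by (rule continuous_map_snd)
    then show "continuous_map T euclideanreal (\<lambda>p. snd p 0)"
      by (simp add: C_def Euclidean_space_def continuous_map_in_subtopology
          continuous_map_componentwise_UNIV)
    have "continuous_map (subtopology T {p \<in> topspace T. snd p 0 \<le> 1/2}) T
        (\<lambda>p. (fst p, (snd p)(0 := 2 * snd p 0 - 0)))"
      by (rule stretch) (auto dest: range)
    from continuous_map_compose [OF this H(1)]
    show "continuous_map (subtopology T {p \<in> topspace T. snd p 0 \<le> 1/2}) X
        (\<lambda>p. H (fst p, (snd p)(0 := 2 * snd p 0 - 0)))"
      by (simp add: o_def)
    have "continuous_map (subtopology T {p \<in> topspace T. 1/2 \<le> snd p 0}) T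
        (\<lambda>p. (fst p, (snd p)(0 := 2 * snd p 0 - 1)))"
      by (rule stretch) (auto dest: range)
    from continuous_map_compose [OF this K(1)]
    show "continuous_map (subtopology T {p \<in> topspace T. 1/2 \<le> snd p 0}) X
        (\<lambda>p. K (fst p, (snd p)(0 := 2 * snd p 0 - 1)))"
      by (simp add: o_def)
    fix p assume p: "p \<in> topspace T" "snd p 0 = 1/2"
    then have s: "fst p \<in> {0..1}"
      by (simp add: topT)
    have "(snd p)(0 := 1) \<in> cube_boundary n" "(snd p)(0 := 0) \<in> cube_boundary n"
      using p n by (auto simp: topT cube_boundary_def cube_def topspace_Euclidean_space)
    then show "H (fst p, (snd p)(0 := 2 * snd p 0 - 0)) = K (fst p, (snd p)(0 := 2 * snd p 0 - 1))"
      using H(4) [OF s] K(4) [OF s] by (simp add: p(2))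
  qed simp
  then have "continuous_map T X L"
    by (simp add: L_def [abs_def] concat_spheroid_def cong: if_cong)
  moreover have "L (s, t) = x0" if "s \<in> {0..1}" "t \<in> cube_boundary n" for s t
    unfolding L_def using that H(4) K(4) by (auto intro!: concat_spheroid_boundary)
  moreover have "L (0, t) = concat_spheroid a b t" "L (1, t) = concat_spheroid a' b' t" for t
    by (simp_all add: L_def concat_spheroid_def H(2,3) K(2,3))
  ultimately show ?thesis
    unfolding spheroid_homotopic_def homotopic_with_def T_def [symmetric] C_def [symmetric]
    by (intro exI [where x = L] conjI) auto
qed

lemma spheroid_concat:
  "spheroid n X x0 a \<Longrightarrow> spheroid n X x0 b \<Longrightarrow> 0 < n \<Longrightarrow> spheroid n X x0 (concat_spheroid a b)"
  using spheroid_homotopic_concat by (metis spheroid_homotopic_refl_iff)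

lemma compose_concat_spheroid:
  "f \<circ> concat_spheroid a b = concat_spheroid (f \<circ> a) (f \<circ> b)"
  by (auto simp: concat_spheroid_def)

lemma mult_spheroid_class:
  assumes "spheroid n X x0 a" and "spheroid n X x0 b" and "0 < n"
  shows "spheroid_class n X x0 a \<otimes>\<^bsub>homotopy_group n X x0\<^esub> spheroid_class n X x0 b
    = spheroid_class n X x0 (concat_spheroid a b)"
proof -
  have "(\<exists>a'. spheroid_homotopic n X x0 a a' \<and> (\<exists>b'. spheroid_homotopic n X x0 b b' \<and>
          spheroid_homotopic n X x0 (concat_spheroid a' b') c))
      \<longleftrightarrow> spheroid_homotopic n X x0 (concat_spheroid a b) c" for c
    using assms unfolding spheroid_homotopic_refl_iff [symmetric]
    by (blast intro: spheroid_homotopic_concat spheroid_homotopic_trans)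
  then show ?thesis
    by (auto simp: homotopy_group_def spheroid_class_def)
qed

section \<open>Functoriality of the homotopy groups\<close>

lemma homotopy_group_map_class:
  assumes f: "based_map X x0 Y y0 f" and a: "spheroid n X x0 a"
  shows "homotopy_group_map n Y y0 (based_class X x0 Y y0 f) (spheroid_class n X x0 a)
    = spheroid_class n Y y0 (f \<circ> a)"
proof -
  have "(\<exists>f'. based_homotopic X x0 Y y0 f f' \<and> (\<exists>a'. spheroid_homotopic n X x0 a a' \<and>
          spheroid_homotopic n Y y0 (f' \<circ> a') c))
      \<longleftrightarrow> spheroid_homotopic n Y y0 (f \<circ> a) c" for c
    using f a unfolding based_homotopic_refl_iff [symmetric] spheroid_homotopic_refl_iff [symmetric]
    by (blast intro: spheroid_homotopic_compose spheroid_homotopic_trans)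
  then show ?thesis
    by (auto simp: homotopy_group_map_def spheroid_class_def based_class_def)
qed

lemma homotopy_group_map_in_carrier:
  assumes "based_map X x0 Y y0 f" and "A \<in> carrier (homotopy_group n X x0)"
  shows "homotopy_group_map n Y y0 (based_class X x0 Y y0 f) A \<in> carrier (homotopy_group n Y y0)"
  using assms by (auto simp: carrier_homotopy_group homotopy_group_map_class spheroid_compose)

lemma homotopy_group_map_id:
  assumes "A \<in> carrier (homotopy_group n X x0)"
  shows "homotopy_group_map n X x0 (based_class X x0 X x0 id) A = A"
  using assms by (auto simp: carrier_homotopy_group homotopy_group_map_class based_map_id)

lemma homotopy_group_map_compose:
  assumes "based_map X x0 Y y0 f" and "based_map Y y0 Z z0 g"
    and "A \<in> carrier (homotopy_group n X x0)"
  shows "homotopy_group_map n Z z0 (based_class X x0 Z z0 (g \<circ> f)) A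
    = homotopy_group_map n Z z0 (based_class Y y0 Z z0 g)
        (homotopy_group_map n Y y0 (based_class X x0 Y y0 f) A)"
  using assms
  by (auto simp: carrier_homotopy_group homotopy_group_map_class spheroid_compose
      based_map_compose comp_assoc)

lemma homotopy_group_map_hom:
  assumes f: "based_map X x0 Y y0 f" and n: "0 < n"
  shows "homotopy_group_map n Y y0 (based_class X x0 Y y0 f)
    \<in> hom (homotopy_group n X x0) (homotopy_group n Y y0)"
proof (rule homI)
  fix A B
  assume "A \<in> carrier (homotopy_group n X x0)" "B \<in> carrier (homotopy_group n X x0)"
  then obtain a b where "spheroid n X x0 a" "A = spheroid_class n X x0 a"
      "spheroid n X x0 b" "B = spheroid_class n X x0 b"
    by (auto simp: carrier_homotopy_group)
  then show "homotopy_group_map n Y y0 (based_class X x0 Y y0 f) (A \<otimes>\<^bsub>homotopy_group n X x0\<^esub> B)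
    = homotopy_group_map n Y y0 (based_class X x0 Y y0 f) A \<otimes>\<^bsub>homotopy_group n Y y0\<^esub>
      homotopy_group_map n Y y0 (based_class X x0 Y y0 f) B"
    using f n by (simp add: mult_spheroid_class homotopy_group_map_class spheroid_concat
        spheroid_compose compose_concat_spheroid)
qed (rule homotopy_group_map_in_carrier [OF f])

lemma induces_iso_iff_bij_betw:
  assumes "based_map X x0 X x0 h"
  shows "induces_iso n X x0 (based_class X x0 X x0 h) \<longleftrightarrow>
    bij_betw (homotopy_group_map n X x0 (based_class X x0 X x0 h))
      (carrier (homotopy_group n X x0)) (carrier (homotopy_group n X x0))"
  using homotopy_group_map_hom [OF assms] by (auto simp: induces_iso_def iso_def)

section \<open>Based homotopy equivalences\<close>

text \<open>Functoriality makes a homotopy inverse of \<open>f\<close> induce an inverse function.\<close>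

lemma bij_betw_homotopy_group_map_equivalence:
  assumes "based_homotopy_equivalence X x0 Y y0 f"
  shows "bij_betw (homotopy_group_map n Y y0 (based_class X x0 Y y0 f))
    (carrier (homotopy_group n X x0)) (carrier (homotopy_group n Y y0))"
proof -
  obtain g where f: "based_map X x0 Y y0 f" and g: "based_map Y y0 X x0 g"
    and gf: "based_homotopic X x0 X x0 (g \<circ> f) id" and fg: "based_homotopic Y y0 Y y0 (f \<circ> g) id"
    using assms by (auto simp: based_homotopy_equivalence_def)
  have "based_class X x0 X x0 (g \<circ> f) = based_class X x0 X x0 id"
    and "based_class Y y0 Y y0 (f \<circ> g) = based_class Y y0 Y y0 id"
    using gf fg by (simp_all add: based_class_eq_iff based_map_id)
  then have "homotopy_group_map n X x0 (based_class Y y0 X x0 g)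
        (homotopy_group_map n Y y0 (based_class X x0 Y y0 f) A) = A"
      if "A \<in> carrier (homotopy_group n X x0)" for A
    using homotopy_group_map_compose [OF f g that] homotopy_group_map_id [OF that] by simp
  moreover have "homotopy_group_map n Y y0 (based_class X x0 Y y0 f)
        (homotopy_group_map n X x0 (based_class Y y0 X x0 g) A) = A"
      if "A \<in> carrier (homotopy_group n Y y0)" for A
    using homotopy_group_map_compose [OF g f that] homotopy_group_map_id [OF that]
      \<open>based_class Y y0 Y y0 (f \<circ> g) = based_class Y y0 Y y0 id\<close> by simp
  ultimately show ?thesis
    using homotopy_group_map_in_carrier [OF f] homotopy_group_map_in_carrier [OF g]
    by (intro bij_betw_byWitness
        [where f' = "homotopy_group_map n X x0 (based_class Y y0 X x0 g)"]) auto
qed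

lemma based_homotopy_equivalence_compose:
  assumes "based_homotopy_equivalence X x0 Y y0 f" and "based_homotopy_equivalence Y y0 Z z0 g"
  shows "based_homotopy_equivalence X x0 Z z0 (g \<circ> f)"
proof -
  obtain f' where f: "based_map X x0 Y y0 f" and f': "based_map Y y0 X x0 f'"
    and f'f: "based_homotopic X x0 X x0 (f' \<circ> f) id"
    and ff': "based_homotopic Y y0 Y y0 (f \<circ> f') id"
    using assms(1) by (auto simp: based_homotopy_equivalence_def)
  obtain g' where g: "based_map Y y0 Z z0 g" and g': "based_map Z z0 Y y0 g'"
    and g'g: "based_homotopic Y y0 Y y0 (g' \<circ> g) id"
    and gg': "based_homotopic Z z0 Z z0 (g \<circ> g') id"
    using assms(2) by (auto simp: based_homotopy_equivalence_def)
  note refl = based_homotopic_refl_iff [THEN iffD2]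
  have "based_homotopic X x0 X x0 (f' \<circ> ((g' \<circ> g) \<circ> f)) (f' \<circ> (id \<circ> f))"
    by (rule based_homotopic_compose [OF based_homotopic_compose [OF refl [OF f] g'g] refl [OF f']])
  then have "based_homotopic X x0 X x0 ((f' \<circ> g') \<circ> (g \<circ> f)) (f' \<circ> f)"
    by (simp add: comp_assoc)
  then have "based_homotopic X x0 X x0 ((f' \<circ> g') \<circ> (g \<circ> f)) id"
    using f'f by (rule based_homotopic_trans)
  moreover have "based_homotopic Z z0 Z z0 (g \<circ> ((f \<circ> f') \<circ> g')) (g \<circ> (id \<circ> g'))"
    by (rule based_homotopic_compose [OF based_homotopic_compose [OF refl [OF g'] ff'] refl [OF g]])
  then have "based_homotopic Z z0 Z z0 ((g \<circ> f) \<circ> (f' \<circ> g')) (g \<circ> g')"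
    by (simp add: comp_assoc)
  then have "based_homotopic Z z0 Z z0 ((g \<circ> f) \<circ> (f' \<circ> g')) id"
    using gg' by (rule based_homotopic_trans)
  ultimately show ?thesis
    unfolding based_homotopy_equivalence_def
    using based_map_compose [OF f g] based_map_compose [OF g' f'] by blast
qed

lemma based_homotopy_equivalence_homotopic:
  assumes "based_homotopy_equivalence X x0 Y y0 f" and ff': "based_homotopic X x0 Y y0 f f'"
  shows "based_homotopy_equivalence X x0 Y y0 f'"
proof -
  obtain g where g: "based_map Y y0 X x0 g"
    and gf: "based_homotopic X x0 X x0 (g \<circ> f) id" and fg: "based_homotopic Y y0 Y y0 (f \<circ> g) id"
    using assms(1) by (auto simp: based_homotopy_equivalence_def)
  note refl = based_homotopic_refl_iff [THEN iffD2]
  have "based_homotopic X x0 X x0 (g \<circ> f') id"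
    using based_homotopic_compose [OF based_homotopic_sym [OF ff'] refl [OF g]] gf
    by (rule based_homotopic_trans)
  moreover have "based_homotopic Y y0 Y y0 (f' \<circ> g) id"
    using based_homotopic_compose [OF refl [OF g] based_homotopic_sym [OF ff']] fg
    by (rule based_homotopic_trans)
  ultimately show ?thesis
    unfolding based_homotopy_equivalence_def
    using g based_homotopic_imp_based_map(2) [OF ff'] by blast
qed

lemma same_based_homotopy_type_sym:
  "same_based_homotopy_type X x0 Y y0 \<Longrightarrow> same_based_homotopy_type Y y0 X x0"
  by (auto simp: same_based_homotopy_type_def based_homotopy_equivalence_def)

section \<open>Invariance of the self-closeness number\<close>

text \<open>Being a homotopy equivalence depends only on the based homotopy class, so it can be tested on
  any representative.\<close>

lemma based_class_in_self_equivalences_iff: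
  assumes "based_map X x0 X x0 h"
  shows "based_class X x0 X x0 h \<in> self_equivalences X x0 \<longleftrightarrow>
    based_homotopy_equivalence X x0 X x0 h"
proof
  assume "based_class X x0 X x0 h \<in> self_equivalences X x0"
  then obtain e where e: "based_homotopy_equivalence X x0 X x0 e"
    and "based_class X x0 X x0 e = based_class X x0 X x0 h"
    by (metis (no_types, lifting) self_equivalences_eq_image imageE mem_Collect_eq)
  then have "based_homotopic X x0 X x0 e h"
    using assms by (simp add: based_class_eq_iff)
  with e show "based_homotopy_equivalence X x0 X x0 h"
    by (rule based_homotopy_equivalence_homotopic)
qed (simp add: self_equivalences_eq_image)

lemma self_equivalences_subset_A_sharp: "self_equivalences X x0 \<subseteq> A_sharp k X x0"
proof
  fix F assume "F \<in> self_equivalences X x0"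
  then obtain h where h: "based_homotopy_equivalence X x0 X x0 h" "F = based_class X x0 X x0 h"
    by (auto simp: self_equivalences_eq_image)
  moreover from h have "based_map X x0 X x0 h"
    by (simp add: based_homotopy_equivalence_def)
  ultimately show "F \<in> A_sharp k X x0"
    by (simp add: A_sharp_def based_classes_eq_image induces_iso_iff_bij_betw
        bij_betw_homotopy_group_map_equivalence)
qed

text \<open>In each degree the map induced by \<open>f \<circ> h \<circ> g\<close> is that of \<open>h\<close> composed with two
  bijections.\<close>

lemma A_sharp_conjugate:
  assumes f: "based_homotopy_equivalence X x0 Y y0 f"
    and g: "based_homotopy_equivalence Y y0 X x0 g"
    and h: "based_map X x0 X x0 h" and A: "based_class X x0 X x0 h \<in> A_sharp k X x0"
  shows "based_class Y y0 Y y0 (f \<circ> (h \<circ> g)) \<in> A_sharp k Y y0"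
proof -
  have maps: "based_map X x0 Y y0 f" "based_map Y y0 X x0 g"
    using f g by (simp_all add: based_homotopy_equivalence_def)
  then have hg: "based_map Y y0 X x0 (h \<circ> g)" and fhg: "based_map Y y0 Y y0 (f \<circ> (h \<circ> g))"
    using h by (auto intro: based_map_compose)
  have "induces_iso i Y y0 (based_class Y y0 Y y0 (f \<circ> (h \<circ> g)))" if "i \<le> k" for i
  proof -
    let ?G = "homotopy_group_map i X x0 (based_class Y y0 X x0 g)"
    let ?H = "homotopy_group_map i X x0 (based_class X x0 X x0 h)"
    let ?F = "homotopy_group_map i Y y0 (based_class X x0 Y y0 f)"
    have "bij_betw ?H (carrier (homotopy_group i X x0)) (carrier (homotopy_group i X x0))"
      using A that h by (simp add: A_sharp_def induces_iso_iff_bij_betw)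
    then have "bij_betw (?F \<circ> (?H \<circ> ?G))
        (carrier (homotopy_group i Y y0)) (carrier (homotopy_group i Y y0))"
      using bij_betw_homotopy_group_map_equivalence [OF f]
        bij_betw_homotopy_group_map_equivalence [OF g] by (blast intro: bij_betw_trans)
    moreover have "homotopy_group_map i Y y0 (based_class Y y0 Y y0 (f \<circ> (h \<circ> g))) A
        = (?F \<circ> (?H \<circ> ?G)) A" if "A \<in> carrier (homotopy_group i Y y0)" for A
      using that homotopy_group_map_compose [OF hg maps(1)] homotopy_group_map_compose [OF maps(2) h]
      by simp
    ultimately show ?thesis
      using fhg by (simp add: induces_iso_iff_bij_betw cong: bij_betw_cong)
  qed
  then show ?thesis
    using fhg by (simp add: A_sharp_def based_classes_eq_image)
qed

text \<open>A self-map \<open>h\<close> of \<open>X\<close> is recovered up to homotopy from its conjugate \<open>f \<circ> h \<circ> g\<close> by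
  conjugating back with \<open>g\<close> and \<open>f\<close>.\<close>

lemma A_sharp_eq_self_equivalences_transfer:
  assumes "same_based_homotopy_type X x0 Y y0" and Y: "A_sharp k Y y0 = self_equivalences Y y0"
  shows "A_sharp k X x0 = self_equivalences X x0"
proof
  obtain f g where f: "based_homotopy_equivalence X x0 Y y0 f"
    and g: "based_homotopy_equivalence Y y0 X x0 g"
    and gf: "based_homotopic X x0 X x0 (g \<circ> f) id"
    using assms(1) by (auto simp: same_based_homotopy_type_def based_homotopy_equivalence_def)
  have maps: "based_map X x0 Y y0 f" "based_map Y y0 X x0 g"
    using f g by (simp_all add: based_homotopy_equivalence_def)
  show "A_sharp k X x0 \<subseteq> self_equivalences X x0"
  proof
    fix F assume F: "F \<in> A_sharp k X x0"
    then obtain h where h: "based_map X x0 X x0 h" and Fh: "F = based_class X x0 X x0 h"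
      by (auto simp: A_sharp_def based_classes_eq_image)
    have "based_map Y y0 Y y0 (f \<circ> (h \<circ> g))"
      using maps h by (auto intro: based_map_compose)
    moreover have "based_class Y y0 Y y0 (f \<circ> (h \<circ> g)) \<in> self_equivalences Y y0"
      using A_sharp_conjugate [OF f g h F [unfolded Fh]] Y by simp
    ultimately have "based_homotopy_equivalence Y y0 Y y0 (f \<circ> (h \<circ> g))"
      by (simp add: based_class_in_self_equivalences_iff)
    then have "based_homotopy_equivalence X x0 X x0 (g \<circ> ((f \<circ> (h \<circ> g)) \<circ> f))"
      using f g by (blast intro: based_homotopy_equivalence_compose)
    moreover have "based_homotopic X x0 X x0 ((g \<circ> f) \<circ> (h \<circ> (g \<circ> f))) (id \<circ> (h \<circ> id))"
      by (rule based_homotopic_compose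
          [OF based_homotopic_compose [OF gf based_homotopic_refl_iff [THEN iffD2, OF h]] gf])
    then have "based_homotopic X x0 X x0 (g \<circ> ((f \<circ> (h \<circ> g)) \<circ> f)) h"
      by (simp add: comp_assoc)
    ultimately have "based_homotopy_equivalence X x0 X x0 h"
      by (rule based_homotopy_equivalence_homotopic)
    then show "F \<in> self_equivalences X x0"
      using Fh by (simp add: self_equivalences_eq_image)
  qed
qed (rule self_equivalences_subset_A_sharp)

theorem theorem1:
  fixes X :: "'a topology" and x0 :: 'a and Y :: "'b topology" and y0 :: 'b
  assumes "based_CW_complex X x0" and "connected_space X"
    and "based_CW_complex Y y0" and "connected_space Y"
    and "same_based_homotopy_type X x0 Y y0"
  shows "self_closeness_number X x0 = self_closeness_number Y y0"
proof -
  have "A_sharp k X x0 = self_equivalences X x0 \<longleftrightarrow> A_sharp k Y y0 = self_equivalences Y y0" for k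
    using A_sharp_eq_self_equivalences_transfer [OF assms(5)]
      A_sharp_eq_self_equivalences_transfer [OF same_based_homotopy_type_sym [OF assms(5)]] by blast
  then show ?thesis
    by (simp add: self_closeness_number_def)
qed

end
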